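(* Consider the Geometric Gradient Method with Momentum (GGMM, described in the context) with $a\ge1$ and $\tau>0$, with stopping condition based on B-stationarity. Assume that $f$ is continuously differentiable. Assume moreover that one of the following holds: (a) the max-rule is used to set $\mu_k$, and $f$ is bounded from below and uniformly continuous on the sublevel set $\mathcal L_0=\{x\in D\mid f(x)\le f(x_0)\}$; (b) the average-rule is used to set $\mu_k$. If, for every $k$, $x_k$ is not a B-stationary point, then any accumulation point $\bar x$ of the sequence $\{x_k\}$ generated by GGMM is a B-stationary point of the problem $\min_{x\in D} f(x)$.
   Context: Let $\mathbb X$ be a Euclidean space (finite-dimensional real inner product space), $f:\mathbb X\to\mathbb R$ differentiable, $D\subset\mathbb X$ nonempty and closed (not necessarily convex). The problem is $\min f(x)$ subject to $x\in D$. The set-valued projection is $P_D(x)=\operatorname{argmin}_{z\in D}\|z-x\|$ (nonempty and compact for every $x$). Stationarity. For $x\in D$, a vector $v$ is tangent to $D$ at $x$ if there are sequences $z_k\in D$, $t_k>0$ with $z_k\to x$, $t_k\to 0$, $(z_k-x)/t_k\to v$; $T_D(x)$ is the set of tangent vectors. The regular normal cone is $\widehat{\mathcal N}_D(x)=\{v\in\mathbb X\mid \langle v,w\rangle\le 0\ \forall w\in T_D(x)\}$. A point $x\in D$ is B-stationary if $-\nabla f(x)\in\widehat{\mathcal N}_D(x)$. GGMM. Inputs: $x_0\in D$, $0\le\tau<\alpha_{\min}\le\alpha_{\max}<\infty$, $\beta_{\max}\ge0$, $c\in(0,1)$, $\delta\in(0,1)$, $a\ge1$. Set $x_{-1}=x_0$.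 For $k=0,1,2,\dots$, as long as $x_k$ does not satisfy the stopping condition (being a stationary point of the chosen type): choose any $\alpha_{k0}\in[\alpha_{\min},\alpha_{\max}]$ and $\beta_{k0}\in[0,\beta_{\max}]$; set a reference value $\mu_k\ge f(x_k)$; for $j=0,1,2,\dots$ let $\alpha_{kj}=\delta^j\alpha_{k0}$, $\beta_{kj}=\beta_{k0}$ if $j=0$ and $\beta_{kj}=\beta_{k0}\left(\frac{\max\{\alpha_{kj}-\tau,0\}}{\alpha_{k0}-\tau}\right)^a$ if $j\ge1$, and choose any $y_{kj}\in P_D(x_k-\alpha_{kj}\nabla f(x_k)+\beta_{kj}(x_k-x_{k-1}))$; the inner loop (backtracking) stops at the first $j$ such that $f(y_{kj})\le\mu_k-\frac{c}{2\alpha_{kj}}\|y_{kj}-x_k\|^2$. With this $j$, set $\alpha_k=\alpha_{kj}$, $\beta_k=\beta_{kj}$, $x_{k+1}=y_{kj}$. Rules for $\mu_k$. Max-rule, for some fixed $M\in\mathbb N$: $\mu_k=\max_{i\in\{\max\{0,k-M\},\dots,k\}}f(x_i)$. Average-rule, for some fixed $p\in(0,1]$: $\mu_k=(1-p)\mu_{k-1}+p f(x_k)$, with initial value $\mu_{-1}\ge f(x_0)$ (e.g. $\mu_{-1}=f(x_0)$). *)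

theory Defs
  imports "HOL-Analysis.Analysis"
begin

definition grad :: "('a::real_inner \<Rightarrow> real) \<Rightarrow> 'a \<Rightarrow> 'a" where
  "grad f x = (THE d. GDERIV f x :> d)"

lemma GDERIV_grad:
  fixes f :: "'a::euclidean_space \<Rightarrow> real"
  assumes "f differentiable (at x)"
  shows "GDERIV f x :> grad f x"
proof -
  obtain f' where f': "(f has_derivative f') (at x)"
    using assms by (auto simp: differentiable_def)
  then interpret bounded_linear f' by (rule has_derivative_bounded_linear)
  define d where "d = adjoint f' 1"
  have "f' h = h \<bullet> d" for h
    using adjoint_works[OF linear_axioms, of h 1] by (simp add: d_def)
  then have "f' = (\<lambda>h. h \<bullet> d)"
    by (rule ext)
  with f' have "GDERIV f x :> d"
    by (simp add: gderiv_def)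
  moreover have "e = d" if "GDERIV f x :> e" for e
  proof -
    have "(\<lambda>h. h \<bullet> e) = (\<lambda>h. h \<bullet> d)"
      using that \<open>GDERIV f x :> d\<close> unfolding gderiv_def by (rule has_derivative_unique)
    then show ?thesis
      unfolding fun_eq_iff by (simp only: vector_eq_ldot)
  qed
  ultimately show ?thesis
    unfolding grad_def by (rule theI)
qed

definition proj_set :: "'a::real_inner set \<Rightarrow> 'a \<Rightarrow> 'a set" where
  "proj_set D x = {z. is_arg_min (\<lambda>z. norm (z - x)) (\<lambda>z. z \<in> D) z}"

definition tangent_cone :: "'a::real_inner set \<Rightarrow> 'a \<Rightarrow> 'a set" where
  "tangent_cone D x = {v. \<exists>z t. (\<forall>k::nat. z k \<in> D) \<and> (\<forall>k. t k > (0::real)) \<and>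
     z \<longlonglongrightarrow> x \<and> t \<longlonglongrightarrow> 0 \<and> (\<lambda>k. (z k - x) /\<^sub>R t k) \<longlonglongrightarrow> v}"

definition regular_normal_cone :: "'a::real_inner set \<Rightarrow> 'a \<Rightarrow> 'a set" where
  "regular_normal_cone D x = {v. \<forall>w\<in>tangent_cone D x. v \<bullet> w \<le> 0}"

definition B_stationary :: "'a::real_inner set \<Rightarrow> ('a \<Rightarrow> real) \<Rightarrow> 'a \<Rightarrow> bool" where
  "B_stationary D f x \<longleftrightarrow> x \<in> D \<and> - grad f x \<in> regular_normal_cone D x"

definition ggmm_params :: "real \<Rightarrow> real \<Rightarrow> real \<Rightarrow> real \<Rightarrow> real \<Rightarrow> real \<Rightarrow> real \<Rightarrow> bool" where
  "ggmm_params \<tau> \<alpha>min \<alpha>max \<beta>max c \<delta> a \<longleftrightarrow>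
     0 \<le> \<tau> \<and> \<tau> < \<alpha>min \<and> \<alpha>min \<le> \<alpha>max \<and> 0 \<le> \<beta>max \<and>
     0 < c \<and> c < 1 \<and> 0 < \<delta> \<and> \<delta> < 1 \<and> 1 \<le> a"

definition ggmm_alpha :: "real \<Rightarrow> real \<Rightarrow> nat \<Rightarrow> real" where
  "ggmm_alpha \<delta> \<alpha>0 j = \<delta> ^ j * \<alpha>0"

definition ggmm_beta :: "real \<Rightarrow> real \<Rightarrow> real \<Rightarrow> real \<Rightarrow> real \<Rightarrow> nat \<Rightarrow> real" where
  "ggmm_beta \<tau> \<delta> a \<alpha>0 \<beta>0 j =
     (if j = 0 then \<beta>0
      else \<beta>0 * (max (ggmm_alpha \<delta> \<alpha>0 j - \<tau>) 0 / (\<alpha>0 - \<tau>)) powr a)"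

definition ggmm_accept :: "('a::real_inner \<Rightarrow> real) \<Rightarrow> real \<Rightarrow> real \<Rightarrow> 'a \<Rightarrow> real \<Rightarrow> 'a \<Rightarrow> bool" where
  "ggmm_accept f c \<mu> x \<alpha> y \<longleftrightarrow> f y \<le> \<mu> - c / (2 * \<alpha>) * (norm (y - x))\<^sup>2"

(* One outer iteration from x (with predecessor xprev and reference value \<mu>) to xnext.
   The choices of the initial step size, the initial momentum coefficient and the
   projections y j are nondeterministic; J is the first index accepted by the backtracking. *)
definition ggmm_step ::
  "'a::real_inner set \<Rightarrow> ('a \<Rightarrow> real) \<Rightarrow> real \<Rightarrow> real \<Rightarrow> real \<Rightarrow> real \<Rightarrow> real \<Rightarrow> real \<Rightarrow> real \<Rightarrow>
    'a \<Rightarrow> 'a \<Rightarrow> real \<Rightarrow> 'a \<Rightarrow> bool" where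
  "ggmm_step D f \<tau> \<alpha>min \<alpha>max \<beta>max c \<delta> a xprev x \<mu> xnext \<longleftrightarrow>
     (\<exists>\<alpha>0\<in>{\<alpha>min..\<alpha>max}. \<exists>\<beta>0\<in>{0..\<beta>max}. \<exists>(y :: nat \<Rightarrow> 'a) J.
        (\<forall>j\<le>J. y j \<in> proj_set D (x - ggmm_alpha \<delta> \<alpha>0 j *\<^sub>R grad f x
                                     + ggmm_beta \<tau> \<delta> a \<alpha>0 \<beta>0 j *\<^sub>R (x - xprev))) \<and>
        (\<forall>j<J. \<not> ggmm_accept f c \<mu> x (ggmm_alpha \<delta> \<alpha>0 j) (y j)) \<and>
        ggmm_accept f c \<mu> x (ggmm_alpha \<delta> \<alpha>0 J) (y J) \<and>
        xnext = y J)"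

(* Truncated subtraction on nat makes x (0 - 1) = x 0, which is the convention that the
   iterate with index -1 equals the initial one. Nothing is required of x and \<mu> beyond
   the first iterate that satisfies the stopping condition. *)
definition ggmm_run ::
  "('a::real_inner \<Rightarrow> bool) \<Rightarrow> 'a set \<Rightarrow> ('a \<Rightarrow> real) \<Rightarrow>
    real \<Rightarrow> real \<Rightarrow> real \<Rightarrow> real \<Rightarrow> real \<Rightarrow> real \<Rightarrow> real \<Rightarrow> 'a \<Rightarrow> (nat \<Rightarrow> 'a) \<Rightarrow> (nat \<Rightarrow> real) \<Rightarrow> bool" where
  "ggmm_run stop D f \<tau> \<alpha>min \<alpha>max \<beta>max c \<delta> a x0 x \<mu> \<longleftrightarrow>
     ggmm_params \<tau> \<alpha>min \<alpha>max \<beta>max c \<delta> a \<and> x0 \<in> D \<and> x 0 = x0 \<and>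
     (\<forall>k. (\<forall>i\<le>k. \<not> stop (x i)) \<longrightarrow>
        \<mu> k \<ge> f (x k) \<and>
        ggmm_step D f \<tau> \<alpha>min \<alpha>max \<beta>max c \<delta> a (x (k - 1)) (x k) (\<mu> k) (x (Suc k)))"

(* k - M is truncated, i.e. it denotes max {0, k - M}. *)
definition max_rule :: "('a \<Rightarrow> real) \<Rightarrow> nat \<Rightarrow> (nat \<Rightarrow> 'a) \<Rightarrow> (nat \<Rightarrow> real) \<Rightarrow> bool" where
  "max_rule f M x \<mu> \<longleftrightarrow> (\<forall>k. \<mu> k = (MAX i\<in>{k - M..k}. f (x i)))"

(* \<mu>init is the initial value with index -1. *)
definition average_rule :: "('a \<Rightarrow> real) \<Rightarrow> real \<Rightarrow> real \<Rightarrow> (nat \<Rightarrow> 'a) \<Rightarrow> (nat \<Rightarrow> real) \<Rightarrow> bool" where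
  "average_rule f p \<mu>init x \<mu> \<longleftrightarrow>
     0 < p \<and> p \<le> 1 \<and> \<mu>init \<ge> f (x 0) \<and>
     (\<forall>k. \<mu> k = (1 - p) * (case k of 0 \<Rightarrow> \<mu>init | Suc l \<Rightarrow> \<mu> l) + p * f (x k))"

end

theory Submission
  imports Defs
begin

text \<open>
  Write \<open>g\<close> for the gradient at the accumulation point \<open>xbar\<close>. The steps \<open>x (Suc k) - x k\<close>
  tend to zero, because the reference values decrease to a limit and a step that does not become
  short would keep pushing them down by a fixed amount (\<open>average_rule_steps_vanish\<close>,
  \<open>max_rule_steps_vanish\<close>). Hence the momentum terms vanish as well, and for each fixed backtracking depth \<open>j\<close> the trial points computed near \<open>xbar\<close>
  accumulate at projections of \<open>xbar - (\<delta> ^ j * \<alpha>) g\<close> onto \<open>D\<close>, where \<open>\<alpha>\<close> is an accumulation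
  point of the initial step sizes.

  Along the subsequence there are two possibilities. If some depth \<open>j\<close> is accepted infinitely
  often, the trial points at that depth are the next iterates, so their limit is \<open>xbar\<close> itself.
  Then \<open>xbar\<close> is a fixed point of a projected gradient step, which makes \<open>- g\<close> a regular normal
  (\<open>regular_normal_if_fixed_point\<close>).

  Otherwise every depth is rejected infinitely often. Using only the last rejected step sizes
  would yield normals at points that merely converge to \<open>xbar\<close>, hence only a limiting normal at
  \<open>xbar\<close>, which is weaker. Instead, the limit is taken separately at every depth \<open>j\<close>. This gives
  a whole geometric family of step sizes for which a projected gradient step from the single
  point \<open>xbar\<close> at best satisfies the decrease condition with equality. This forces a displacement \<open>o(\<delta> ^ j)\<close>
  (\<open>rejected_displacement_small\<close>), whereas a feasible tangent direction of descent would move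
  the projection by an amount proportional to the step size; this contradiction is
  \<open>regular_normal_if_small_displacements\<close>.
\<close>

section \<open>Projections onto closed sets\<close>

lemma proj_set_iff:
  "z \<in> proj_set D u \<longleftrightarrow> z \<in> D \<and> (\<forall>w\<in>D. norm (z - u) \<le> norm (w - u))"
  by (auto simp: proj_set_def is_arg_min_def not_less)

lemma proj_set_limit:
  assumes "closed D" and mem: "\<And>n. y n \<in> proj_set D (u n)"
    and y: "y \<longlonglongrightarrow> y'" and u: "u \<longlonglongrightarrow> u'"
  shows "y' \<in> proj_set D u'"
proof -
  have "y' \<in> D"
    using closed_sequentially[OF \<open>closed D\<close>, of y y'] mem y by (auto simp: proj_set_iff)
  moreover have "norm (y' - u') \<le> norm (w - u')" if "w \<in> D" for w
  proof (rule LIMSEQ_le)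
    show "(\<lambda>n. norm (y n - u n)) \<longlonglongrightarrow> norm (y' - u')"
      by (intro tendsto_intros y u)
    show "(\<lambda>n. norm (w - u n)) \<longlonglongrightarrow> norm (w - u')"
      by (intro tendsto_intros u)
    show "\<exists>N. \<forall>n\<ge>N. norm (y n - u n) \<le> norm (w - u n)"
      using mem that by (auto simp: proj_set_iff)
  qed
  ultimately show ?thesis
    by (simp add: proj_set_iff)
qed

lemma proj_set_convergent_subsequence:
  fixes y :: "nat \<Rightarrow> 'a::euclidean_space"
  assumes "closed D" and mem: "\<And>n. y n \<in> proj_set D (u n)" and u: "u \<longlonglongrightarrow> u'"
  obtains y' s where "strict_mono (s :: nat \<Rightarrow> nat)" "(y \<circ> s) \<longlonglongrightarrow> y'" "y' \<in> proj_set D u'"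
proof -
  obtain B where B: "\<And>n. norm (u n) \<le> B"
    using u Bseq_def convergent_imp_Bseq convergentI by metis
  have "norm (y n) \<le> norm (y 0) + 2 * B" for n
  proof -
    have "norm (y n) \<le> norm (y n - u n) + norm (u n)"
      using norm_triangle_sub[of "y n" "u n"] by simp
    also have "norm (y n - u n) \<le> norm (y 0 - u n)"
      using mem by (simp add: proj_set_iff)
    also have "norm (y 0 - u n) \<le> norm (y 0) + norm (u n)"
      by (rule norm_triangle_ineq4)
    finally show ?thesis
      using B[of n] by simp
  qed
  then have "bounded (range y)"
    by (auto intro: boundedI)
  then obtain y' s where s: "strict_mono (s :: nat \<Rightarrow> nat)" and y': "(y \<circ> s) \<longlonglongrightarrow> y'"
    using bounded_imp_convergent_subsequence by blast
  have "y' \<in> proj_set D u'"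
  proof (rule proj_set_limit[OF \<open>closed D\<close> _ y'])
    show "(u \<circ> s) \<longlonglongrightarrow> u'"
      by (rule LIMSEQ_subseq_LIMSEQ[OF u s])
  qed (simp add: mem)
  with s y' show ?thesis
    by (rule that)
qed

text \<open>Expanding the squares in the minimality of a projected gradient step, with the common
  term \<open>(\<alpha> * norm g)\<^sup>2\<close> cancelled.\<close>

lemma proj_set_gradient_step:
  assumes "y \<in> proj_set D (x - \<alpha> *\<^sub>R g)" and "z \<in> D"
  shows "(norm (y - x))\<^sup>2 + 2 * \<alpha> * (g \<bullet> (y - x)) \<le> (norm (z - x))\<^sup>2 + 2 * \<alpha> * (g \<bullet> (z - x))"
proof -
  have expand: "(norm (v - (x - \<alpha> *\<^sub>R g)))\<^sup>2
      = (norm (v - x))\<^sup>2 + 2 * \<alpha> * (g \<bullet> (v - x)) + (norm (\<alpha> *\<^sub>R g))\<^sup>2" for v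
  proof -
    have "v - (x - \<alpha> *\<^sub>R g) = (v - x) + \<alpha> *\<^sub>R g"
      by simp
    then show ?thesis
      by (simp only: power2_norm_eq_inner inner_simps) (simp add: inner_commute algebra_simps)
  qed
  have "(norm (y - (x - \<alpha> *\<^sub>R g)))\<^sup>2 \<le> (norm (z - (x - \<alpha> *\<^sub>R g)))\<^sup>2"
    using assms by (intro power_mono) (auto simp: proj_set_iff)
  then show ?thesis
    unfolding expand by simp
qed

lemma proj_set_gradient_lower_bound:
  assumes "y \<in> proj_set D (x - \<alpha> *\<^sub>R g)" and "z \<in> D" and "\<alpha> > 0"
  shows "g \<bullet> (z - x) \<ge> - (norm g * norm (y - x)) - (norm (z - x))\<^sup>2 / (2 * \<alpha>)"
proof -
  have "g \<bullet> (y - x) \<ge> - (norm g * norm (y - x))"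
    using Cauchy_Schwarz_ineq2[of g "y - x"] by linarith
  moreover have "2 * \<alpha> * (g \<bullet> (y - x)) \<le> (norm (z - x))\<^sup>2 + 2 * \<alpha> * (g \<bullet> (z - x))"
    using proj_set_gradient_step[OF assms(1,2)] zero_le_power2[of "norm (y - x)"] by linarith
  then have "g \<bullet> (y - x) \<le> (norm (z - x))\<^sup>2 / (2 * \<alpha>) + g \<bullet> (z - x)"
    using \<open>\<alpha> > 0\<close> by (simp add: field_simps)
  ultimately show ?thesis
    by linarith
qed

section \<open>From projected gradient steps to regular normals\<close>

lemma regular_normal_if_fixed_point:
  assumes fix_x: "x \<in> proj_set D (x - \<alpha> *\<^sub>R g)" and "\<alpha> > 0"
  shows "- g \<in> regular_normal_cone D x"
  unfolding regular_normal_cone_def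
proof (safe, goal_cases)
  case (1 w)
  then obtain z t where z: "\<And>k::nat. z k \<in> D" and t: "\<And>k. t k > (0::real)"
    and zx: "z \<longlonglongrightarrow> x" and w: "(\<lambda>k. (z k - x) /\<^sub>R t k) \<longlonglongrightarrow> w"
    by (auto simp: tangent_cone_def)
  define v where "v = (\<lambda>k. (z k - x) /\<^sub>R t k)"
  have zv: "z k - x = t k *\<^sub>R v k" for k
    using t[of k] by (simp add: v_def)
  have "- (norm (z k - x) * norm (v k)) / (2 * \<alpha>) \<le> g \<bullet> v k" for k
  proof -
    have "(norm (z k - x))\<^sup>2 = t k * (norm (z k - x) * norm (v k))"
      using t[of k] by (simp add: zv power2_eq_square)
    moreover have "- (norm (z k - x))\<^sup>2 / (2 * \<alpha>) \<le> g \<bullet> (z k - x)"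
      using proj_set_gradient_lower_bound[OF fix_x z \<open>\<alpha> > 0\<close>, of k] by simp
    moreover have "g \<bullet> (z k - x) = t k * (g \<bullet> v k)"
      by (simp add: zv)
    ultimately have "t k * (- (norm (z k - x) * norm (v k)) / (2 * \<alpha>)) \<le> t k * (g \<bullet> v k)"
      by simp
    then show ?thesis
      using t[of k] by (simp only: mult_le_cancel_left_pos)
  qed
  moreover have "(\<lambda>k. - (norm (z k - x) * norm (v k)) / (2 * \<alpha>))
      \<longlonglongrightarrow> - (norm (x - x) * norm w) / (2 * \<alpha>)"
    unfolding v_def by (intro tendsto_intros zx w) (use \<open>\<alpha> > 0\<close> in simp)
  moreover have "(\<lambda>k. g \<bullet> v k) \<longlonglongrightarrow> g \<bullet> w"
    unfolding v_def by (intro tendsto_intros w)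
  ultimately have "- (norm (x - x) * norm w) / (2 * \<alpha>) \<le> g \<bullet> w"
    by (intro LIMSEQ_le) auto
  then show ?case
    by simp
qed

text \<open>A single projected gradient step only controls the tangent sequence at distances
  comparable with its step size: points much closer to \<open>x\<close> are masked by the displacement
  \<open>y j - x\<close>, points much further away by the quadratic term. Geometrically decreasing step
  sizes reach every small scale up to the factor \<open>\<delta>\<close>, so each point \<open>x + t w\<close> of the tangent
  sequence can be tested with a step size \<open>\<alpha> * \<delta> ^ j\<close> of order \<open>t / \<kappa>\<close>; this gives
  \<open>g \<bullet> w \<ge> - const * \<kappa>\<close>, and \<open>\<kappa>\<close> is arbitrary.\<close>

lemma regular_normal_if_small_displacements:
  assumes y: "\<And>j. y j \<in> proj_set D (x - (\<delta> ^ j * \<alpha>) *\<^sub>R g)"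
    and small: "\<And>\<epsilon>. \<epsilon> > 0 \<Longrightarrow> \<forall>\<^sub>F j in sequentially. norm (y j - x) \<le> \<epsilon> * (\<delta> ^ j * \<alpha>)"
    and "\<alpha> > 0" and \<delta>: "0 < \<delta>" "\<delta> < 1"
  shows "- g \<in> regular_normal_cone D x"
  unfolding regular_normal_cone_def
proof (safe, goal_cases)
  case (1 w)
  then obtain z t where z: "\<And>k::nat. z k \<in> D" and t: "\<And>k. t k > (0::real)"
    and t0: "t \<longlonglongrightarrow> 0" and w: "(\<lambda>k. (z k - x) /\<^sub>R t k) \<longlonglongrightarrow> w"
    by (auto simp: tangent_cone_def)
  define v where "v = (\<lambda>k. (z k - x) /\<^sub>R t k)"
  have zv: "z k - x = t k *\<^sub>R v k" for k
    using t[of k] by (simp add: v_def)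
  have bound: "- (\<kappa> * (norm g / \<delta> + (norm w)\<^sup>2 / 2)) \<le> g \<bullet> w" if "\<kappa> > 0" for \<kappa>
  proof -
    \<comment> \<open>A relative displacement \<open>\<epsilon>\<close> costs \<open>norm g * \<epsilon> / (\<kappa> * \<delta>)\<close>, so \<open>\<epsilon> = \<kappa>\<^sup>2\<close> balances it
      with the quadratic term \<open>\<kappa> * (norm w)\<^sup>2 / 2\<close>.\<close>
    obtain N where N: "\<And>j. j \<ge> N \<Longrightarrow> norm (y j - x) \<le> \<kappa>\<^sup>2 * (\<delta> ^ j * \<alpha>)"
      using small[of "\<kappa>\<^sup>2"] \<open>\<kappa> > 0\<close> by (auto simp: eventually_sequentially)
    have "\<forall>\<^sub>F k in sequentially. t k < \<kappa> * (\<delta> ^ N * \<alpha>)"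
      using \<open>\<kappa> > 0\<close> \<open>\<alpha> > 0\<close> \<delta> by (intro order_tendstoD(2)[OF t0]) simp
    then have "\<forall>\<^sub>F k in sequentially. - (\<kappa> * (norm g / \<delta> + (norm (v k))\<^sup>2 / 2)) \<le> g \<bullet> v k"
    proof eventually_elim
      case (elim k)
      have "(\<lambda>j. \<kappa> * (\<delta> ^ Suc j * \<alpha>)) \<longlonglongrightarrow> \<kappa> * (0 * \<alpha>)"
        using LIMSEQ_power_zero[of \<delta>] \<delta> by (intro tendsto_intros LIMSEQ_Suc) auto
      then have "\<forall>\<^sub>F j in sequentially. \<kappa> * (\<delta> ^ Suc j * \<alpha>) < t k"
        using t[of k] by (intro order_tendstoD(2)) auto
      then obtain i where i: "\<kappa> * (\<delta> ^ Suc i * \<alpha>) < t k"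
        by (auto simp: eventually_sequentially)
      define j where "j = (LEAST j. \<kappa> * (\<delta> ^ Suc j * \<alpha>) < t k)"
      have lower: "\<kappa> * (\<delta> ^ Suc j * \<alpha>) < t k"
        unfolding j_def using i by (rule LeastI)
      have upper: "t k \<le> \<kappa> * (\<delta> ^ j * \<alpha>)"
      proof (cases j)
        case 0
        have "\<delta> ^ N \<le> 1"
          using \<delta> by (simp add: power_le_one)
        then have "\<kappa> * (\<delta> ^ N * \<alpha>) \<le> \<kappa> * (1 * \<alpha>)"
          using \<open>\<kappa> > 0\<close> \<open>\<alpha> > 0\<close> by (intro mult_left_mono mult_right_mono) auto
        with elim 0 show ?thesis
          by simp
      next
        case (Suc i)
        then have "\<not> \<kappa> * (\<delta> ^ Suc i * \<alpha>) < t k"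
          using not_less_Least[of i "\<lambda>j. \<kappa> * (\<delta> ^ Suc j * \<alpha>) < t k"] by (simp add: j_def)
        with Suc show ?thesis
          by simp
      qed
      have "j \<ge> N"
      proof (rule ccontr)
        assume "\<not> N \<le> j"
        then have "\<delta> ^ N \<le> \<delta> ^ Suc j"
          using \<delta> by (intro power_decreasing) auto
        then have "\<kappa> * (\<delta> ^ N * \<alpha>) \<le> \<kappa> * (\<delta> ^ Suc j * \<alpha>)"
          using \<open>\<kappa> > 0\<close> \<open>\<alpha> > 0\<close> by (intro mult_left_mono mult_right_mono) auto
        with elim lower show False
          by simp
      qed
      define A where "A = \<delta> ^ j * \<alpha>"
      have "A > 0"
        using \<open>\<alpha> > 0\<close> \<delta> by (simp add: A_def)
      have lowerA: "\<kappa> * A \<le> t k / \<delta>" and upperA: "t k \<le> \<kappa> * A"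
        using lower upper \<delta> by (simp_all add: A_def field_simps)
      have disp: "norm (y j - x) \<le> \<kappa> * (t k / \<delta>)"
      proof -
        have "norm (y j - x) \<le> \<kappa> * (\<kappa> * A)"
          using N[OF \<open>j \<ge> N\<close>] by (simp add: A_def power2_eq_square mult.assoc)
        also have "\<dots> \<le> \<kappa> * (t k / \<delta>)"
          using lowerA \<open>\<kappa> > 0\<close> by (intro mult_left_mono) auto
        finally show ?thesis .
      qed
      have quad: "(norm (z k - x))\<^sup>2 / (2 * A) \<le> t k * (\<kappa> * (norm (v k))\<^sup>2 / 2)"
      proof -
        have "(norm (z k - x))\<^sup>2 / (2 * A) = t k * (norm (v k))\<^sup>2 * (t k / (2 * A))"
          by (simp add: zv power_mult_distrib power2_eq_square)
        also have "\<dots> \<le> t k * (norm (v k))\<^sup>2 * (\<kappa> / 2)"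
          using upperA t[of k] \<open>A > 0\<close> by (intro mult_left_mono) (auto simp: field_simps)
        finally show ?thesis
          by (simp add: mult_ac)
      qed
      have "- (norm g * (\<kappa> * (t k / \<delta>))) - t k * (\<kappa> * (norm (v k))\<^sup>2 / 2) \<le> g \<bullet> (z k - x)"
        using proj_set_gradient_lower_bound[OF y[of j, folded A_def] z \<open>A > 0\<close>, of k]
          quad mult_left_mono[OF disp norm_ge_zero[of g]] by linarith
      then have "t k * (- (\<kappa> * (norm g / \<delta> + (norm (v k))\<^sup>2 / 2))) \<le> t k * (g \<bullet> v k)"
        by (simp add: zv algebra_simps)
      then show ?case
        using t[of k] by (simp only: mult_le_cancel_left_pos)
    qed
    moreover have "(\<lambda>k. - (\<kappa> * (norm g / \<delta> + (norm (v k))\<^sup>2 / 2)))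
        \<longlonglongrightarrow> - (\<kappa> * (norm g / \<delta> + (norm w)\<^sup>2 / 2))"
      unfolding v_def by (intro tendsto_intros w) simp
    moreover have "(\<lambda>k. g \<bullet> v k) \<longlonglongrightarrow> g \<bullet> w"
      unfolding v_def by (intro tendsto_intros w)
    ultimately show ?thesis
      by (intro tendsto_le[OF sequentially_bot])
  qed
  have "((\<lambda>\<kappa>. - (\<kappa> * (norm g / \<delta> + (norm w)\<^sup>2 / 2))) \<longlongrightarrow> - (0 * (norm g / \<delta> + (norm w)\<^sup>2 / 2)))
      (at_right 0)"
    by (intro tendsto_intros)
  moreover have "\<forall>\<^sub>F \<kappa> in at_right 0. - (\<kappa> * (norm g / \<delta> + (norm w)\<^sup>2 / 2)) \<le> g \<bullet> w"
    using bound by (auto simp: eventually_at_right_field intro: exI[of _ 1])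
  ultimately have "- (0 * (norm g / \<delta> + (norm w)\<^sup>2 / 2)) \<le> g \<bullet> w"
    by (intro tendsto_upperbound) auto
  then show ?case
    by simp
qed

text \<open>A projected gradient step \<open>s = y j - x\<close> satisfies \<open>g \<bullet> s \<le> - (norm s)\<^sup>2 / (2 \<alpha>)\<close>, so to
  first order it decreases \<open>f\<close> by the full amount \<open>(norm s)\<^sup>2 / (2 \<alpha>)\<close>. Failing to achieve the
  fraction \<open>c < 1\<close> of it is possible only if \<open>(norm s)\<^sup>2 / \<alpha>\<close> is dominated by the first-order
  remainder, which is \<open>o (norm s)\<close> because \<open>norm s \<le> 2 \<alpha> norm g\<close> tends to zero.\<close>

lemma rejected_displacement_small:
  assumes f: "GDERIV f x :> g" and "x \<in> D"
    and y: "\<And>j. y j \<in> proj_set D (x - \<alpha> j *\<^sub>R g)"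
    and rej: "\<And>j. f (y j) \<ge> f x - c / (2 * \<alpha> j) * (norm (y j - x))\<^sup>2"
    and \<alpha>: "\<And>j. \<alpha> j > 0" "\<alpha> \<longlonglongrightarrow> 0" and "c < 1" and "\<epsilon> > 0"
  shows "\<forall>\<^sub>F j in sequentially. norm (y j - x) \<le> \<epsilon> * \<alpha> j"
proof -
  define e where "e = \<epsilon> * (1 - c) / 2"
  have "e > 0"
    using \<open>c < 1\<close> \<open>\<epsilon> > 0\<close> by (simp add: e_def)
  have "\<forall>e>0. \<exists>d>0. \<forall>y. norm (y - x) < d \<longrightarrow> norm (f y - f x - (y - x) \<bullet> g) \<le> e * norm (y - x)"
    using f by (simp add: gderiv_def has_derivative_at_alt)
  then obtain d where "d > 0"
    and d: "\<And>y. norm (y - x) < d \<Longrightarrow> norm (f y - f x - (y - x) \<bullet> g) \<le> e * norm (y - x)"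
    using \<open>e > 0\<close> by blast
  have "(\<lambda>j. 2 * \<alpha> j * norm g) \<longlonglongrightarrow> 2 * 0 * norm g"
    by (intro tendsto_intros \<alpha>)
  then have "\<forall>\<^sub>F j in sequentially. 2 * \<alpha> j * norm g < d"
    using \<open>d > 0\<close> by (intro order_tendstoD(2)) auto
  then show ?thesis
  proof eventually_elim
    case (elim j)
    define s where "s = norm (y j - x)"
    have step: "s\<^sup>2 + 2 * \<alpha> j * (g \<bullet> (y j - x)) \<le> 0"
      using proj_set_gradient_step[OF y \<open>x \<in> D\<close>, of j] by (simp add: s_def)
    show ?case
    proof (cases "s = 0")
      case True
      then show ?thesis
        using \<alpha>(1)[of j] \<open>\<epsilon> > 0\<close> by (simp add: s_def)
    next
      case False
      then have "s > 0"
        by (simp add: s_def)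
      have "g \<bullet> (y j - x) \<ge> - (norm g * s)"
        using Cauchy_Schwarz_ineq2[of g "y j - x"] by (simp add: s_def)
      then have "2 * \<alpha> j * (g \<bullet> (y j - x)) \<ge> 2 * \<alpha> j * (- (norm g * s))"
        using \<alpha>(1)[of j] by (intro mult_left_mono) auto
      with step have "s * s \<le> s * (2 * \<alpha> j * norm g)"
        by (simp add: power2_eq_square algebra_simps)
      with \<open>s > 0\<close> elim have "s < d"
        by simp
      then have "f (y j) - f x - g \<bullet> (y j - x) \<le> e * s"
        using d[of "y j"] by (simp add: s_def inner_commute)
      moreover have "2 * \<alpha> j * (f (y j) - f x) \<ge> - c * s\<^sup>2"
        using rej[of j] \<alpha>(1)[of j] by (simp add: s_def field_simps)
      moreover have "2 * \<alpha> j * (f (y j) - f x - g \<bullet> (y j - x)) \<le> 2 * \<alpha> j * (e * s)"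
        using calculation(1) \<alpha>(1)[of j] by (intro mult_left_mono) auto
      ultimately have "(1 - c) * s\<^sup>2 \<le> 2 * \<alpha> j * (e * s)"
        using step by (simp add: algebra_simps)
      then have "((1 - c) * s) * s \<le> ((1 - c) * (\<epsilon> * \<alpha> j)) * s"
        by (simp add: e_def power2_eq_square algebra_simps)
      then show ?thesis
        using \<open>s > 0\<close> \<open>c < 1\<close> by (simp add: s_def)
    qed
  qed
qed

section \<open>Vanishing steps under nonmonotone sufficient decrease\<close>

lemma tendsto_zero_of_square_bound:
  fixes d e :: "nat \<Rightarrow> real"
  assumes "\<forall>\<^sub>F k in sequentially. C * (d k)\<^sup>2 \<le> e k" and "C > 0" and "e \<longlonglongrightarrow> 0"
  shows "d \<longlonglongrightarrow> 0"
proof -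
  have "(\<lambda>k. (d k)\<^sup>2) \<longlonglongrightarrow> 0"
  proof (rule Lim_null_comparison)
    show "\<forall>\<^sub>F k in sequentially. norm ((d k)\<^sup>2) \<le> e k / C"
      using assms(1) by eventually_elim (use \<open>C > 0\<close> in \<open>simp add: field_simps\<close>)
    show "(\<lambda>k. e k / C) \<longlonglongrightarrow> 0"
      using tendsto_divide[OF \<open>e \<longlonglongrightarrow> 0\<close> tendsto_const[of C]] \<open>C > 0\<close> by simp
  qed
  from tendsto_real_sqrt[OF this] show ?thesis
    by (simp add: tendsto_rabs_zero_iff)
qed

text \<open>With the average rule each step lowers the reference value by a fixed fraction of the
  sufficient decrease. Since the reference values bound those of \<open>f\<close> from above, convergence
  of \<open>f\<close> along one subsequence already keeps them from tending to \<open>-\<infinity>\<close>.\<close>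

lemma average_rule_steps_vanish:
  fixes x :: "nat \<Rightarrow> 'a::real_inner"
  assumes rule: "average_rule f p \<mu>init x \<mu>"
    and ref: "\<And>k. f (x k) \<le> \<mu> k"
    and dec: "\<And>k. f (x (Suc k)) \<le> \<mu> k - C * (norm (x (Suc k) - x k))\<^sup>2" and "C > 0"
    and r: "strict_mono (r :: nat \<Rightarrow> nat)" and lim: "(\<lambda>l. f (x (r l))) \<longlonglongrightarrow> m"
  shows "(\<lambda>k. norm (x (Suc k) - x k)) \<longlonglongrightarrow> 0"
proof -
  have p: "0 < p" and rec: "\<mu> (Suc k) = (1 - p) * \<mu> k + p * f (x (Suc k))" for k
    using rule by (auto simp: average_rule_def)
  have drop: "p * C * (norm (x (Suc k) - x k))\<^sup>2 \<le> \<mu> k - \<mu> (Suc k)" for k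
  proof -
    have "p * f (x (Suc k)) \<le> p * (\<mu> k - C * (norm (x (Suc k) - x k))\<^sup>2)"
      using dec p by (intro mult_left_mono) auto
    then show ?thesis
      unfolding rec by (simp add: algebra_simps)
  qed
  have "\<mu> (Suc k) \<le> \<mu> k" for k
  proof -
    have "0 \<le> p * C * (norm (x (Suc k) - x k))\<^sup>2"
      using p \<open>C > 0\<close> by simp
    with drop[of k] show ?thesis
      by linarith
  qed
  then have "decseq \<mu>"
    by (rule decseq_SucI)
  obtain B where B: "\<And>l. norm (f (x (r l))) \<le> B"
    using lim Bseq_def convergent_imp_Bseq convergentI by metis
  have "- B \<le> \<mu> l" for l
  proof -
    have "- B \<le> f (x (r l))"
      using B[of l] by (simp add: abs_le_iff)
    also have "\<dots> \<le> \<mu> (r l)"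
      by (rule ref)
    also have "\<dots> \<le> \<mu> l"
      using \<open>decseq \<mu>\<close> seq_suble[OF r, of l] by (rule decseqD)
    finally show ?thesis .
  qed
  then obtain L where L: "\<mu> \<longlonglongrightarrow> L"
    using decseq_convergent[OF \<open>decseq \<mu>\<close>] by metis
  have "(\<lambda>k. \<mu> k - \<mu> (Suc k)) \<longlonglongrightarrow> 0"
    using tendsto_diff[OF L LIMSEQ_Suc[OF L]] by simp
  then show ?thesis
    using drop p \<open>C > 0\<close> by - (rule tendsto_zero_of_square_bound[where C = "p * C"], auto)
qed

text \<open>With the max rule the reference values decrease to a limit \<open>L\<close>, and they are attained at
  iterates \<open>x (l k)\<close> of recent index. Sufficient decrease forces the step leading to an iterate
  whose value is close to \<open>L\<close> to be short, and uniform continuity then transports closeness to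
  \<open>L\<close> back to the preceding iterate. Repeating this \<open>M\<close> times reaches every index \<open>k\<close>, because
  \<open>k \<le> l (k + M) \<le> k + M\<close>.\<close>

lemma max_rule_steps_vanish:
  fixes x :: "nat \<Rightarrow> 'a::real_inner"
  assumes rule: "max_rule f M x \<mu>"
    and dec: "\<And>k. f (x (Suc k)) \<le> \<mu> k - C * (norm (x (Suc k) - x k))\<^sup>2" and "C > 0"
    and xD: "\<And>k. x k \<in> D"
    and bdd: "bdd_below (f ` {z \<in> D. f z \<le> f (x 0)})"
    and unif: "uniformly_continuous_on {z \<in> D. f z \<le> f (x 0)} f"
  shows "(\<lambda>k. norm (x (Suc k) - x k)) \<longlonglongrightarrow> 0"
proof -
  have \<mu>: "\<mu> k = (MAX i\<in>{k - M..k}. f (x i))" for k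
    using rule by (simp add: max_rule_def)
  have ref: "f (x i) \<le> \<mu> k" if "k - M \<le> i" "i \<le> k" for i k
    unfolding \<mu> using that by (intro Max_ge) auto
  have dec0: "f (x (Suc k)) \<le> \<mu> k" for k
  proof -
    have "0 \<le> C * (norm (x (Suc k) - x k))\<^sup>2"
      using \<open>C > 0\<close> by simp
    with dec[of k] show ?thesis
      by linarith
  qed
  have "\<exists>i\<in>{k - M..k}. f (x i) = \<mu> k" for k
  proof -
    have "\<mu> k \<in> (\<lambda>i. f (x i)) ` {k - M..k}"
      unfolding \<mu> by (rule Max_in) auto
    then show ?thesis
      by force
  qed
  then obtain l where l: "\<And>k. k - M \<le> l k" "\<And>k. l k \<le> k" and fl: "\<And>k. f (x (l k)) = \<mu> k"
    by (metis atLeastAtMost_iff)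
  have "\<mu> (Suc k) \<le> \<mu> k" for k
  proof (cases "l (Suc k) = Suc k")
    case True
    then show ?thesis
      using dec0[of k] fl[of "Suc k"] by simp
  next
    case False
    then have "k - M \<le> l (Suc k)" "l (Suc k) \<le> k"
      using l[of "Suc k"] by auto
    then show ?thesis
      using ref fl[of "Suc k"] by metis
  qed
  then have "decseq \<mu>"
    by (rule decseq_SucI)
  have f0: "f (x k) \<le> f (x 0)" for k
  proof -
    have "f (x k) \<le> \<mu> k"
      by (rule ref) auto
    also have "\<mu> k \<le> \<mu> 0"
      using \<open>decseq \<mu>\<close> by (rule decseqD) simp
    also have "\<mu> 0 = f (x 0)"
      using fl[of 0] l[of 0] by simp
    finally show ?thesis .
  qed
  then have level: "x k \<in> {z \<in> D. f z \<le> f (x 0)}" for k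
    using xD by simp
  obtain B where "\<And>k. B \<le> f (x k)"
    using bdd level unfolding bdd_below_def by blast
  then have "B \<le> \<mu> k" for k
    using fl[of k] by metis
  then obtain L where L: "\<mu> \<longlonglongrightarrow> L"
    using decseq_convergent[OF \<open>decseq \<mu>\<close>] by metis
  have shift: "filterlim (\<lambda>k. l k - j) sequentially sequentially" for j
    unfolding filterlim_at_top eventually_sequentially
  proof (intro allI)
    fix Z
    show "\<exists>N. \<forall>n\<ge>N. Z \<le> l n - j"
    proof (intro exI[of _ "Z + j + M"] allI impI)
      fix n assume "Z + j + M \<le> n"
      then show "Z \<le> l n - j"
        using l(1)[of n] by linarith
    qed
  qed
  have earlier: "(\<lambda>k. f (x (l k - j))) \<longlonglongrightarrow> L" for j
  proof (induction j)
    case 0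
    then show ?case
      using L by (simp add: fl)
  next
    case (Suc j)
    have "(\<lambda>k. \<mu> (l k - Suc j)) \<longlonglongrightarrow> L"
      by (rule filterlim_compose[OF L shift])
    from tendsto_diff[OF this Suc.IH]
    have gap: "(\<lambda>k. \<mu> (l k - Suc j) - f (x (l k - j))) \<longlonglongrightarrow> 0"
      by simp
    have "\<forall>\<^sub>F k in sequentially. j + 1 + M \<le> k"
      by (rule eventually_ge_at_top)
    then have "\<forall>\<^sub>F k in sequentially. C * (norm (x (l k - j) - x (l k - Suc j)))\<^sup>2
        \<le> \<mu> (l k - Suc j) - f (x (l k - j))"
    proof eventually_elim
      case (elim k)
      \<comment> \<open>As \<open>l k \<ge> k - M > j\<close>, no subtraction is truncated.\<close>
      then have "Suc (l k - Suc j) = l k - j"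
        using l(1)[of k] by linarith
      with dec[of "l k - Suc j"] show ?case
        by simp
    qed
    then have "(\<lambda>k. norm (x (l k - j) - x (l k - Suc j))) \<longlonglongrightarrow> 0"
      using \<open>C > 0\<close> gap by (rule tendsto_zero_of_square_bound)
    then have "(\<lambda>k. dist (x (l k - j)) (x (l k - Suc j))) \<longlonglongrightarrow> 0"
      by (simp add: dist_norm)
    with unif level have "(\<lambda>k. dist (f (x (l k - j))) (f (x (l k - Suc j)))) \<longlonglongrightarrow> 0"
      unfolding uniformly_continuous_on_sequentially
      by (elim allE[of _ "\<lambda>k. x (l k - j)"] allE[of _ "\<lambda>k. x (l k - Suc j)"]) blast
    then have "(\<lambda>k. f (x (l k - j)) - f (x (l k - Suc j))) \<longlonglongrightarrow> 0"
      by (simp add: dist_real_def tendsto_rabs_zero_iff)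
    from tendsto_diff[OF Suc.IH this] show ?case
      by simp
  qed
  have "(\<lambda>k. f (x k)) \<longlonglongrightarrow> L"
  proof (rule tendstoI)
    fix e :: real assume "e > 0"
    have "\<forall>j\<in>{..M}. \<forall>\<^sub>F k in sequentially. dist (f (x (l k - j))) L < e"
      using earlier \<open>e > 0\<close> by (auto intro: tendstoD)
    then have "\<forall>\<^sub>F k in sequentially. \<forall>j\<in>{..M}. dist (f (x (l k - j))) L < e"
      by (simp add: eventually_ball_finite)
    then have "\<forall>\<^sub>F k in sequentially. \<forall>j\<in>{..M}. dist (f (x (l (k + M) - j))) L < e"
      by (rule sequentially_offset)
    then show "\<forall>\<^sub>F k in sequentially. dist (f (x k)) L < e"
    proof eventually_elim
      case (elim k)
      have "l (k + M) - (l (k + M) - k) = k" "l (k + M) - k \<in> {..M}"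
        using l[of "k + M"] by auto
      with elim show ?case
        by metis
    qed
  qed
  from tendsto_diff[OF L LIMSEQ_Suc[OF this]]
  have "(\<lambda>k. \<mu> k - f (x (Suc k))) \<longlonglongrightarrow> 0"
    by simp
  moreover have "\<forall>\<^sub>F k in sequentially. C * (norm (x (Suc k) - x k))\<^sup>2 \<le> \<mu> k - f (x (Suc k))"
  proof (intro always_eventually allI)
    fix k
    show "C * (norm (x (Suc k) - x k))\<^sup>2 \<le> \<mu> k - f (x (Suc k))"
      using dec[of k] by simp
  qed
  ultimately show ?thesis
    using tendsto_zero_of_square_bound \<open>C > 0\<close> by metis
qed

section \<open>Accumulation points\<close>

lemma ggmm_beta_bounds:
  assumes "\<tau> < \<alpha>0" "0 < \<alpha>0" "0 < \<delta>" "\<delta> < 1" "1 \<le> a" "0 \<le> \<beta>0"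
  shows "0 \<le> ggmm_beta \<tau> \<delta> a \<alpha>0 \<beta>0 j" and "ggmm_beta \<tau> \<delta> a \<alpha>0 \<beta>0 j \<le> \<beta>0"
proof -
  define q where "q = max (ggmm_alpha \<delta> \<alpha>0 j - \<tau>) 0 / (\<alpha>0 - \<tau>)"
  have "\<delta> ^ j * \<alpha>0 \<le> 1 * \<alpha>0"
    using assms by (intro mult_right_mono power_le_one) auto
  then have "0 \<le> q" "q \<le> 1"
    using assms by (auto simp: q_def ggmm_alpha_def)
  then have "q powr a \<le> 1"
    using assms by (simp add: powr_le1)
  then have "\<beta>0 * q powr a \<le> \<beta>0"
    using assms by (simp add: mult_left_le)
  with \<open>0 \<le> \<beta>0\<close> show "0 \<le> ggmm_beta \<tau> \<delta> a \<alpha>0 \<beta>0 j" and "ggmm_beta \<tau> \<delta> a \<alpha>0 \<beta>0 j \<le> \<beta>0"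
    by (simp_all add: ggmm_beta_def flip: q_def)
qed

theorem theorem4p8:
  fixes D :: "'a::euclidean_space set" and f :: "'a \<Rightarrow> real"
    and \<tau> \<alpha>min \<alpha>max \<beta>max c \<delta> a :: real
    and x0 xbar :: 'a and x :: "nat \<Rightarrow> 'a" and \<mu> :: "nat \<Rightarrow> real"
  assumes "D \<noteq> {}" and "closed D"
    and "\<forall>z. f differentiable (at z)" and "continuous_on UNIV (grad f)"
    and "ggmm_run (B_stationary D f) D f \<tau> \<alpha>min \<alpha>max \<beta>max c \<delta> a x0 x \<mu>"
    and "\<tau> > 0"
    and "((\<exists>M. max_rule f M x \<mu>) \<and>
           bdd_below (f ` {z \<in> D. f z \<le> f x0}) \<and>
           uniformly_continuous_on {z \<in> D. f z \<le> f x0} f)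
         \<or> (\<exists>p \<mu>init. average_rule f p \<mu>init x \<mu>)"
    and "\<forall>k. \<not> B_stationary D f (x k)"
    and "\<exists>r. strict_mono (r :: nat \<Rightarrow> nat) \<and> (x \<circ> r) \<longlonglongrightarrow> xbar"
  shows "B_stationary D f xbar"
proof -
  from assms(5) have "x 0 = x0" "x0 \<in> D"
    and params: "0 \<le> \<tau>" "\<tau> < \<alpha>min" "\<alpha>min \<le> \<alpha>max" "0 \<le> \<beta>max" "0 < c" "c < 1"
      "0 < \<delta>" "\<delta> < 1" "1 \<le> a"
    by (auto simp: ggmm_run_def ggmm_params_def)
  from assms(5,8) have ref: "\<And>k. f (x k) \<le> \<mu> k"
    and step: "\<And>k. ggmm_step D f \<tau> \<alpha>min \<alpha>max \<beta>max c \<delta> a (x (k - 1)) (x k) (\<mu> k) (x (Suc k))"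
    by (auto simp: ggmm_run_def)
  have "\<exists>\<alpha>0 \<beta>0 y J. \<alpha>0 \<in> {\<alpha>min..\<alpha>max} \<and> \<beta>0 \<in> {0..\<beta>max} \<and>
      (\<forall>j\<le>J. y j \<in> proj_set D (x k - ggmm_alpha \<delta> \<alpha>0 j *\<^sub>R grad f (x k)
                               + ggmm_beta \<tau> \<delta> a \<alpha>0 \<beta>0 j *\<^sub>R (x k - x (k - 1)))) \<and>
      (\<forall>j<J. \<not> ggmm_accept f c (\<mu> k) (x k) (ggmm_alpha \<delta> \<alpha>0 j) (y j)) \<and>
      ggmm_accept f c (\<mu> k) (x k) (ggmm_alpha \<delta> \<alpha>0 J) (y J) \<and> x (Suc k) = y J" for k
    using step[of k] unfolding ggmm_step_def by blast
  then obtain A B Y J where A: "\<And>k. A k \<in> {\<alpha>min..\<alpha>max}" and B: "\<And>k. B k \<in> {0..\<beta>max}"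
    and Y: "\<And>k j. j \<le> J k \<Longrightarrow>
       Y k j \<in> proj_set D (x k - ggmm_alpha \<delta> (A k) j *\<^sub>R grad f (x k)
                               + ggmm_beta \<tau> \<delta> a (A k) (B k) j *\<^sub>R (x k - x (k - 1)))"
    and rej: "\<And>k j. j < J k \<Longrightarrow> \<not> ggmm_accept f c (\<mu> k) (x k) (ggmm_alpha \<delta> (A k) j) (Y k j)"
    and acc: "\<And>k. ggmm_accept f c (\<mu> k) (x k) (ggmm_alpha \<delta> (A k) (J k)) (Y k (J k))"
    and xSuc: "\<And>k. x (Suc k) = Y k (J k)"
    by metis
  have A_pos: "A k > 0" "A k \<le> \<alpha>max" "\<tau> < A k" for k
    using A[of k] params by auto
  obtain r0 where "strict_mono (r0 :: nat \<Rightarrow> nat)" and r0: "(x \<circ> r0) \<longlonglongrightarrow> xbar"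
    using assms(9) by blast
  define g where "g = grad f xbar"
  have f_cont: "isCont f z" for z
    using assms(3) differentiable_imp_continuous_within by blast
  have grad_cont: "isCont (grad f) z" for z
    using assms(4) by (simp add: continuous_on_eq_continuous_at)
  have xD: "x k \<in> D" for k
  proof (cases k)
    case 0
    then show ?thesis
      using \<open>x 0 = x0\<close> \<open>x0 \<in> D\<close> by simp
  next
    case (Suc i)
    then show ?thesis
      using Y[of "J i" i] xSuc[of i] by (simp add: proj_set_iff)
  qed
  then have "xbar \<in> D"
    using closed_sequentially[OF \<open>closed D\<close> _ r0] by simp

  have steps: "(\<lambda>k. norm (x (Suc k) - x k)) \<longlonglongrightarrow> 0"
  proof -
    have "\<alpha>max > 0"
      using params by linarith
    then have C: "c / (2 * \<alpha>max) > 0"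
      using params by simp
    have dec: "f (x (Suc k)) \<le> \<mu> k - c / (2 * \<alpha>max) * (norm (x (Suc k) - x k))\<^sup>2" for k
    proof -
      have "\<delta> ^ J k * A k \<le> 1 * \<alpha>max"
        using params A_pos[of k] by (intro mult_mono power_le_one) auto
      moreover have "0 < \<delta> ^ J k * A k"
        using params A_pos[of k] by simp
      ultimately have "c / (2 * \<alpha>max) \<le> c / (2 * (\<delta> ^ J k * A k))"
        using params by (intro divide_left_mono) auto
      then have "c / (2 * \<alpha>max) * (norm (x (Suc k) - x k))\<^sup>2
          \<le> c / (2 * (\<delta> ^ J k * A k)) * (norm (x (Suc k) - x k))\<^sup>2"
        by (intro mult_right_mono) auto
      with acc[of k] show ?thesis
        by (simp add: ggmm_accept_def ggmm_alpha_def xSuc)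
    qed
    from assms(7) show ?thesis
    proof (elim disjE conjE exE)
      fix M
      assume "max_rule f M x \<mu>" "bdd_below (f ` {z \<in> D. f z \<le> f x0})"
        "uniformly_continuous_on {z \<in> D. f z \<le> f x0} f"
      then show ?thesis
        using max_rule_steps_vanish[where f = f and x = x and \<mu> = \<mu>, OF _ dec C xD] \<open>x 0 = x0\<close> by blast
    next
      fix p \<mu>init
      assume "average_rule f p \<mu>init x \<mu>"
      moreover have "(\<lambda>l. f (x (r0 l))) \<longlonglongrightarrow> f xbar"
        using isCont_tendsto_compose[OF f_cont r0] by (simp add: o_def)
      ultimately show ?thesis
        using average_rule_steps_vanish[where f = f and x = x and \<mu> = \<mu>, OF _ ref dec C \<open>strict_mono r0\<close>] by blast
    qed
  qed
  have momentum: "(\<lambda>k. ggmm_beta \<tau> \<delta> a (A k) (B k) j *\<^sub>R (x k - x (k - 1))) \<longlonglongrightarrow> 0" for j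
  proof (rule Lim_null_comparison)
    show "\<forall>\<^sub>F k in sequentially. norm (ggmm_beta \<tau> \<delta> a (A k) (B k) j *\<^sub>R (x k - x (k - 1)))
        \<le> \<beta>max * norm (x k - x (k - 1))"
    proof (intro always_eventually allI)
      fix k
      have "0 \<le> ggmm_beta \<tau> \<delta> a (A k) (B k) j" "ggmm_beta \<tau> \<delta> a (A k) (B k) j \<le> \<beta>max"
        using ggmm_beta_bounds[of \<tau> "A k" \<delta> a "B k" j] A_pos[of k] B[of k] params by auto
      then show "norm (ggmm_beta \<tau> \<delta> a (A k) (B k) j *\<^sub>R (x k - x (k - 1)))
        \<le> \<beta>max * norm (x k - x (k - 1))"
        by (auto intro: mult_right_mono)
    qed
    have "(\<lambda>k. norm (x k - x (k - 1))) \<longlonglongrightarrow> 0"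
      using steps by (subst filterlim_sequentially_Suc[symmetric]) simp
    from tendsto_mult_right_zero[OF this]
    show "(\<lambda>k. \<beta>max * norm (x k - x (k - 1))) \<longlonglongrightarrow> 0" .
  qed

  have "bounded (range (A \<circ> r0))"
    by (rule bounded_subset[OF bounded_closed_interval[of \<alpha>min \<alpha>max]]) (use A in auto)
  then obtain \<alpha> r1 where "strict_mono (r1 :: nat \<Rightarrow> nat)" and r1: "((A \<circ> r0) \<circ> r1) \<longlonglongrightarrow> \<alpha>"
    using bounded_imp_convergent_subsequence by blast
  define r where "r = r0 \<circ> r1"
  have r: "strict_mono r"
    unfolding r_def using \<open>strict_mono r0\<close> \<open>strict_mono r1\<close> by (rule strict_mono_o)
  have xr: "(x \<circ> r) \<longlonglongrightarrow> xbar"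
    using LIMSEQ_subseq_LIMSEQ[OF r0 \<open>strict_mono r1\<close>] by (simp add: r_def o_assoc)
  have Ar: "(A \<circ> r) \<longlonglongrightarrow> \<alpha>"
    using r1 by (simp add: r_def o_assoc)
  have "\<alpha>min \<le> \<alpha>"
    using A by (intro LIMSEQ_le_const[OF Ar]) auto
  then have "\<alpha> > 0"
    using params by linarith

  \<comment> \<open>The momentum term vanishes, so the points projected at a fixed backtracking depth \<open>j\<close>
    converge to a pure gradient step at the accumulation point.\<close>
  have target: "((\<lambda>k. x k - ggmm_alpha \<delta> (A k) j *\<^sub>R grad f (x k)
      + ggmm_beta \<tau> \<delta> a (A k) (B k) j *\<^sub>R (x k - x (k - 1))) \<circ> (r \<circ> s))
      \<longlonglongrightarrow> xbar - (\<delta> ^ j * \<alpha>) *\<^sub>R g" if s: "strict_mono s" for s j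
  proof -
    have xs: "(\<lambda>l. x (r (s l))) \<longlonglongrightarrow> xbar"
      using LIMSEQ_subseq_LIMSEQ[OF xr s] by (simp add: o_def)
    have As: "(\<lambda>l. A (r (s l))) \<longlonglongrightarrow> \<alpha>"
      using LIMSEQ_subseq_LIMSEQ[OF Ar s] by (simp add: o_def)
    have gs: "(\<lambda>l. grad f (x (r (s l)))) \<longlonglongrightarrow> g"
      unfolding g_def by (rule isCont_tendsto_compose[OF grad_cont xs])
    have ms: "(\<lambda>l. ggmm_beta \<tau> \<delta> a (A (r (s l))) (B (r (s l))) j
        *\<^sub>R (x (r (s l)) - x (r (s l) - 1))) \<longlonglongrightarrow> 0"
      using LIMSEQ_subseq_LIMSEQ[OF momentum strict_mono_o[OF r s]] by (simp add: o_def)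
    have "(\<lambda>l. x (r (s l)) - (\<delta> ^ j * A (r (s l))) *\<^sub>R grad f (x (r (s l)))
        + ggmm_beta \<tau> \<delta> a (A (r (s l))) (B (r (s l))) j
        *\<^sub>R (x (r (s l)) - x (r (s l) - 1))) \<longlonglongrightarrow> xbar - (\<delta> ^ j * \<alpha>) *\<^sub>R g + 0"
      by (intro tendsto_intros xs As gs ms)
    then show ?thesis
      by (simp add: o_def ggmm_alpha_def)
  qed

  have "- g \<in> regular_normal_cone D xbar"
  proof (cases "\<exists>j. infinite {l. J (r l) = j}")
    case True
    then obtain j where "infinite {l. J (r l) = j}"
      by blast
    from infinite_enumerate[OF this] obtain s where s: "strict_mono (s :: nat \<Rightarrow> nat)"
      and J: "\<And>l. J (r (s l)) = j"
      by auto
    have "(\<lambda>k. x (Suc k) - x k) \<longlonglongrightarrow> 0"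
      using steps by (simp add: tendsto_norm_zero_iff)
    from LIMSEQ_subseq_LIMSEQ[OF this strict_mono_o[OF r s]]
    have "(\<lambda>l. x (Suc (r (s l))) - x (r (s l))) \<longlonglongrightarrow> 0"
      by (simp add: o_def)
    from tendsto_add[OF this LIMSEQ_subseq_LIMSEQ[OF xr s]]
    have lim: "(\<lambda>l. x (Suc (r (s l)))) \<longlonglongrightarrow> xbar"
      by (simp add: o_def)
    have "xbar \<in> proj_set D (xbar - (\<delta> ^ j * \<alpha>) *\<^sub>R g)"
    proof (rule proj_set_limit[OF \<open>closed D\<close> _ lim target[OF s, of j]])
      fix l
      show "x (Suc (r (s l))) \<in> proj_set D (((\<lambda>k. x k - ggmm_alpha \<delta> (A k) j *\<^sub>R grad f (x k)
          + ggmm_beta \<tau> \<delta> a (A k) (B k) j *\<^sub>R (x k - x (k - 1))) \<circ> (r \<circ> s)) l)"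
        using Y[of j "r (s l)"] xSuc[of "r (s l)"] J[of l] by simp
    qed
    then show ?thesis
      by (rule regular_normal_if_fixed_point) (use \<open>\<alpha> > 0\<close> params in simp)
  next
    case False
    have "\<exists>y. y \<in> proj_set D (xbar - (\<delta> ^ j * \<alpha>) *\<^sub>R g) \<and>
        f y \<ge> f xbar - c / (2 * (\<delta> ^ j * \<alpha>)) * (norm (y - xbar))\<^sup>2" for j
    proof -
      have "finite (\<Union>i\<in>{..j}. {l. J (r l) = i})"
        using False by (intro finite_UN_I) auto
      moreover have "(\<Union>i\<in>{..j}. {l. J (r l) = i}) = - {l. j < J (r l)}"
        by auto
      ultimately have "infinite {l. j < J (r l)}"
        by (metis finite_compl infinite_UNIV_nat)
      from infinite_enumerate[OF this] obtain s where s: "strict_mono (s :: nat \<Rightarrow> nat)"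
        and J: "\<And>l. j < J (r (s l))"
        by auto
      have mem: "Y (r (s l)) j \<in> proj_set D (((\<lambda>k. x k - ggmm_alpha \<delta> (A k) j *\<^sub>R grad f (x k)
          + ggmm_beta \<tau> \<delta> a (A k) (B k) j *\<^sub>R (x k - x (k - 1))) \<circ> (r \<circ> s)) l)" for l
        using Y[of j "r (s l)"] J[of l] by simp
      obtain y u where u: "strict_mono (u :: nat \<Rightarrow> nat)"
        and yu: "((\<lambda>l. Y (r (s l)) j) \<circ> u) \<longlonglongrightarrow> y"
        and y: "y \<in> proj_set D (xbar - (\<delta> ^ j * \<alpha>) *\<^sub>R g)"
        by (rule proj_set_convergent_subsequence[where y = "\<lambda>l. Y (r (s l)) j",
              OF \<open>closed D\<close> mem target[OF s, of j]])
      define q where "q = r \<circ> (s \<circ> u)"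
      have su: "strict_mono (s \<circ> u)"
        using s u by (rule strict_mono_o)
      have xq: "(\<lambda>l. x (q l)) \<longlonglongrightarrow> xbar"
        using LIMSEQ_subseq_LIMSEQ[OF xr su] by (simp add: o_def q_def)
      have Aq: "(\<lambda>l. A (q l)) \<longlonglongrightarrow> \<alpha>"
        using LIMSEQ_subseq_LIMSEQ[OF Ar su] by (simp add: o_def q_def)
      have Yq: "(\<lambda>l. Y (q l) j) \<longlonglongrightarrow> y"
        using yu by (simp add: o_def q_def)
      have rejq: "f (x (q l)) - c / (2 * (\<delta> ^ j * A (q l))) * (norm (Y (q l) j - x (q l)))\<^sup>2
          \<le> f (Y (q l) j)" for l
        using rej[of j "q l"] J[of "u l"] ref[of "q l"]
        by (simp add: ggmm_accept_def ggmm_alpha_def q_def)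
      have "(\<lambda>l. f (x (q l)) - c / (2 * (\<delta> ^ j * A (q l))) * (norm (Y (q l) j - x (q l)))\<^sup>2)
          \<longlonglongrightarrow> f xbar - c / (2 * (\<delta> ^ j * \<alpha>)) * (norm (y - xbar))\<^sup>2"
        using \<open>\<alpha> > 0\<close> params
        by (intro tendsto_intros xq Aq Yq isCont_tendsto_compose[OF f_cont xq]) simp
      moreover have "(\<lambda>l. f (Y (q l) j)) \<longlonglongrightarrow> f y"
        by (rule isCont_tendsto_compose[OF f_cont Yq])
      ultimately have "f xbar - c / (2 * (\<delta> ^ j * \<alpha>)) * (norm (y - xbar))\<^sup>2 \<le> f y"
        using rejq by (intro LIMSEQ_le) auto
      with y show ?thesis
        by blast
    qed
    then obtain y where y: "\<And>j. y j \<in> proj_set D (xbar - (\<delta> ^ j * \<alpha>) *\<^sub>R g)"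
      and rej_y: "\<And>j. f (y j) \<ge> f xbar - c / (2 * (\<delta> ^ j * \<alpha>)) * (norm (y j - xbar))\<^sup>2"
      by metis
    have "GDERIV f xbar :> g"
      unfolding g_def using assms(3) by (intro GDERIV_grad) simp
    moreover have "(\<lambda>j. \<delta> ^ j * \<alpha>) \<longlonglongrightarrow> 0"
      using params by (intro tendsto_mult_left_zero LIMSEQ_power_zero) simp
    ultimately have "\<forall>\<^sub>F j in sequentially. norm (y j - xbar) \<le> \<epsilon> * (\<delta> ^ j * \<alpha>)" if "\<epsilon> > 0" for \<epsilon>
      using \<open>\<alpha> > 0\<close> params that
      by (intro rejected_displacement_small[OF _ \<open>xbar \<in> D\<close> y rej_y]) auto
    then show ?thesis
      using \<open>\<alpha> > 0\<close> params by (intro regular_normal_if_small_displacements[OF y])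
  qed
  with \<open>xbar \<in> D\<close> show ?thesis
    by (simp add: B_stationary_def g_def)
qed

end
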